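(* Suppose the initial speed is $v_0=0$. Let $\ell\ge0$, $v\ge0$, $t\ge0$, $\mathbf h\in\mathbb R^n$, and suppose $\rho_{\mathcal R_{\boldsymbol v}}(t,\mathbf h)>\ell$. Then the best universal lower estimator $T_{\rho_{\mathcal R_{\boldsymbol v}}}$ satisfies $$T_{\rho_{\mathcal R_{\boldsymbol v}}}(t,\mathbf h)=\begin{cases}+\infty,& v=0,\ 1+\ell\le\lVert\mathbf h\rVert;\\ -\ln(1+\ell-\lVert\mathbf h\rVert),& v=0,\ 1+\ell>\lVert\mathbf h\rVert;\\ \dfrac{vt+\lVert\mathbf h\rVert-1-\ell}{v}+W_0\left(\dfrac{e^{-t+\frac{1+\ell-\lVert\mathbf h\rVert}{v}}}{v}\right),& v>0,\end{cases}$$ where $W_0$ is the principal branch of the Lambert function.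
   Context: Let $n\in\mathbb N$, $n\ge1$; $\lVert\cdot\rVert$ is the Euclidean norm. The set of admissible controls $\mathcal A$ consists of measurable functions $\boldsymbol u$ of time $t\ge0$ with values in the closed unit ball of $\mathbb R^n$. For $\boldsymbol u\in\mathcal A$, $\boldsymbol r(\cdot;\boldsymbol u)$ and $\boldsymbol v(\cdot;\boldsymbol u)$ are the absolutely continuous solutions of $\dot{\boldsymbol r}=\boldsymbol v$, $\dot{\boldsymbol v}=\boldsymbol u-\boldsymbol v$ (a.e.) with $\boldsymbol r(0;\boldsymbol u)=\boldsymbol 0$, $\boldsymbol v(0;\boldsymbol u)=(v_0,0,\dots,0)$. Put $\mathcal R_{\boldsymbol v}(t)=\{\boldsymbol v(t;\boldsymbol u):\boldsymbol u\in\mathcal A\}$ and $\rho_{\mathcal R_{\boldsymbol v}}(t,\mathbf h)=\min_{\tilde{\mathbf h}\in\mathcal R_{\boldsymbol v}(t)}\lVert\mathbf h-\tilde{\mathbf h}\rVert$. For capture radius $\ell\ge0$ and target Lipschitz constant $v\ge0$, the best universal lower estimator is $$T_{\rho}(t,\mathbf h)=\min\{\theta\in[0,\infty):\theta\ge t,\ \rho(\theta,\mathbf h)=v(\theta-t)+\ell\},$$ with $\min\emptyset=+\infty$, used here with $\rho=\rho_{\mathcal R_{\boldsymbol v}}$. $W_0:[-1/e,\infty)\to[-1,\infty)$ is the inverse of $w\mapsto we^w$ on $[-1,\infty)$. *)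

theory Defs
  imports "HOL-Analysis.Analysis"
begin

text \<open>Absolute continuity of a function of one real variable: the finite families of
  non-overlapping compact intervals are the divisions of their own unions.\<close>

definition abs_continuous_on :: "real set \<Rightarrow> (real \<Rightarrow> 'a::real_normed_vector) \<Rightarrow> bool" where
  "abs_continuous_on S f \<longleftrightarrow>
     (\<forall>\<epsilon>>0. \<exists>\<delta>>0. \<forall>D. D division_of \<Union>D \<and> \<Union>D \<subseteq> S \<and> (\<Sum>K\<in>D. Sup K - Inf K) < \<delta>
        \<longrightarrow> (\<Sum>K\<in>D. norm (f (Sup K) - f (Inf K))) < \<epsilon>)"

text \<open>Time is the half-line \<open>{0..}\<close>; values of controls and trajectories at negative times are
  irrelevant.\<close>

definition admissible_controls :: "(real \<Rightarrow> real ^ 'n) set" where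
  "admissible_controls =
     {u. u \<in> borel_measurable (lebesgue_on {0..}) \<and> (\<forall>t\<ge>0. u t \<in> cball 0 1)}"

text \<open>The index \<open>i1\<close> plays the role of the first coordinate, so \<open>axis i1 v0\<close> is
  \<open>(v0, 0, \<dots>, 0)\<close>. Absolute continuity on the half-line means absolute continuity on every
  compact subinterval.\<close>

definition trajectory ::
  "'n \<Rightarrow> real \<Rightarrow> (real \<Rightarrow> real ^ 'n) \<Rightarrow> (real \<Rightarrow> real ^ 'n) \<Rightarrow> (real \<Rightarrow> real ^ 'n) \<Rightarrow> bool" where
  "trajectory i1 v0 u r v \<longleftrightarrow>
     (\<forall>T\<ge>0. abs_continuous_on {0..T} r \<and> abs_continuous_on {0..T} v) \<and>
     (AE t in lebesgue_on {0..}. (r has_vector_derivative v t) (at t within {0..})) \<and>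
     (AE t in lebesgue_on {0..}. (v has_vector_derivative (u t - v t)) (at t within {0..})) \<and>
     r 0 = 0 \<and> v 0 = axis i1 v0"

definition reach_v :: "'n \<Rightarrow> real \<Rightarrow> real \<Rightarrow> (real ^ 'n) set" where
  "reach_v i1 v0 t = {v t | u r v. u \<in> admissible_controls \<and> trajectory i1 v0 u r v}"

text \<open>Both minima below are genuine minima (\<open>LEAST\<close>, not \<open>Inf\<close>): they are unspecified unless
  attained.\<close>

definition rho_reach_v :: "'n \<Rightarrow> real \<Rightarrow> real \<Rightarrow> real ^ 'n \<Rightarrow> real" where
  "rho_reach_v i1 v0 t h = (LEAST d. d \<in> (\<lambda>h'. norm (h - h')) ` reach_v i1 v0 t)"

definition lower_estimator ::
  "(real \<Rightarrow> 'a \<Rightarrow> real) \<Rightarrow> real \<Rightarrow> real \<Rightarrow> real \<Rightarrow> 'a \<Rightarrow> ereal" where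
  "lower_estimator \<rho> v l t h =
     (let S = {\<theta>. 0 \<le> \<theta> \<and> t \<le> \<theta> \<and> \<rho> \<theta> h = v * (\<theta> - t) + l}
      in if S = {} then \<infinity> else ereal (LEAST \<theta>. \<theta> \<in> S))"

text \<open>Principal branch of the Lambert function; only meaningful on \<open>{- exp (-1)..}\<close>.\<close>

definition lambert_W0 :: "real \<Rightarrow> real" where
  "lambert_W0 = the_inv_into {-1..} (\<lambda>w. w * exp w)"

end

theory Submission
  imports Defs
begin

text \<open>
  Starting at rest, the velocities reachable at time \<open>t\<close> fill exactly the closed ball of radius
  \<open>1 - exp (- t)\<close>. They stay in it because the integrating factor \<open>exp s\<close> turns the
  equation into \<open>(exp s *\<^sub>R v s)' = exp s *\<^sub>R u s\<close>, and integrating a vector of length at most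
  \<open>exp s\<close> over \<open>{0..t}\<close> gives at most \<open>exp t - 1\<close>; they fill it because a constant control \<open>c\<close>
  produces the velocity \<open>(1 - exp (- t)) *\<^sub>R c\<close>. Hence the distance from \<open>h\<close> to the reachable
  set is \<open>max 0 (norm h - (1 - exp (- t)))\<close>.

  The only analytic difficulty is that a trajectory satisfies its equation merely almost
  everywhere, so that the integration rests on the fundamental theorem of calculus for
  absolutely continuous functions. It is proved for the Henstock-Kurzweil integral, whose gauges
  handle the exceptional null set directly.

  The estimator then asks for the first \<open>\<theta> \<ge> t\<close> at which the distance equals
  \<open>v * (\<theta> - t) + l\<close>. The difference of the two sides is strictly monotone in \<open>\<theta>\<close> as long as the
  truncation at \<open>0\<close> is ignored, so there is at most one root of the smooth equation
  \<open>norm h - (1 - exp (- \<theta>)) = v * (\<theta> - t) + l\<close>, and this root is the minimum. For \<open>v = 0\<close> it is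
  \<open>- ln (1 + l - norm h)\<close>, unless \<open>1 + l \<le> norm h\<close>: then the bounded velocities never come within
  distance \<open>l\<close> of \<open>h\<close>. For \<open>v > 0\<close>, writing \<open>\<theta> = a + w\<close> with \<open>a = (v * t + norm h - 1 - l) / v\<close> reduces the
  equation to \<open>exp (- a) * exp (- w) = v * w\<close>, that is, \<open>w * exp w = exp (- a) / v\<close>, which is
  solved by the Lambert function.
\<close>

section \<open>Absolutely continuous functions\<close>

lemma division_of_elem_real:
  fixes D :: "real set set"
  assumes "D division_of \<Union>D" "K \<in> D"
  obtains c d where "K = {c..d}" "c \<le> d" "Inf K = c" "Sup K = d"
proof -
  obtain c d where K: "K = cbox c d" "K \<noteq> {}"
    using division_ofD[OF assms(1)] assms(2) by metis
  then have "K = {c..d}" "c \<le> d" by auto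
  then show ?thesis using that by (auto simp: cInf_atLeastAtMost cSup_atLeastAtMost)
qed

lemma lipschitz_imp_abs_continuous_on:
  fixes f :: "real \<Rightarrow> 'a::real_normed_vector"
  assumes lip: "L-lipschitz_on S f"
  shows "abs_continuous_on S f"
  unfolding abs_continuous_on_def
proof (intro allI impI)
  fix e :: real assume "e > 0"
  have L: "L \<ge> 0" using lip lipschitz_on_nonneg by blast
  show "\<exists>d>0. \<forall>D. D division_of \<Union>D \<and> \<Union>D \<subseteq> S \<and> (\<Sum>K\<in>D. Sup K - Inf K) < d
        \<longrightarrow> (\<Sum>K\<in>D. norm (f (Sup K) - f (Inf K))) < e"
  proof (intro exI[of _ "e / (L + 1)"] conjI allI impI)
    show "0 < e / (L + 1)" using L \<open>e > 0\<close> by simp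
    fix D :: "real set set"
    assume D: "D division_of \<Union>D \<and> \<Union>D \<subseteq> S \<and> (\<Sum>K\<in>D. Sup K - Inf K) < e / (L + 1)"
    have "norm (f (Sup K) - f (Inf K)) \<le> L * (Sup K - Inf K)" "Sup K - Inf K \<ge> 0"
      if KD: "K \<in> D" for K
    proof -
      obtain c d where K: "K = {c..d}" "c \<le> d" "Inf K = c" "Sup K = d"
        by (rule division_of_elem_real[of D K]) (use D KD in auto)
      then have "c \<in> K" "d \<in> K" by auto
      then have "c \<in> S" "d \<in> S" using D KD by blast+
      then show "norm (f (Sup K) - f (Inf K)) \<le> L * (Sup K - Inf K)" "Sup K - Inf K \<ge> 0"
        using lipschitz_onD[OF lip, of d c] K by (auto simp: dist_norm)
    qed
    then have *: "(\<Sum>K\<in>D. norm (f (Sup K) - f (Inf K))) \<le> L * (\<Sum>K\<in>D. Sup K - Inf K)"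
      "(\<Sum>K\<in>D. Sup K - Inf K) \<ge> 0"
      by (auto simp: sum_distrib_left intro!: sum_mono sum_nonneg)
    have "L * (\<Sum>K\<in>D. Sup K - Inf K) \<le> (L + 1) * (\<Sum>K\<in>D. Sup K - Inf K)"
      using *(2) by (intro mult_right_mono) auto
    also have "\<dots> < e" using D L by (simp add: field_simps)
    finally show "(\<Sum>K\<in>D. norm (f (Sup K) - f (Inf K))) < e" using * by linarith
  qed
qed

lemma abs_continuous_on_imp_continuous_on:
  fixes f :: "real \<Rightarrow> 'a::real_normed_vector"
  assumes "abs_continuous_on {a..b} f"
  shows "continuous_on {a..b} f"
  unfolding continuous_on_iff
proof (intro ballI allI impI)
  fix x and e :: real assume x: "x \<in> {a..b}" and "e > 0"
  then obtain \<delta> where "\<delta> > 0" and \<delta>: "\<And>D. D division_of \<Union>D \<Longrightarrow> \<Union>D \<subseteq> {a..b} \<Longrightarrow>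
      (\<Sum>K\<in>D. Sup K - Inf K) < \<delta> \<Longrightarrow> (\<Sum>K\<in>D. norm (f (Sup K) - f (Inf K))) < e"
    using assms unfolding abs_continuous_on_def by meson
  have *: "norm (f d - f c) < e" if "a \<le> c" "c \<le> d" "d \<le> b" "d - c < \<delta>" for c d
  proof -
    have "{{c..d}} division_of \<Union>{{c..d}}"
      using division_of_self[of c d] that by auto
    from \<delta>[OF this] that show ?thesis by simp
  qed
  show "\<exists>d>0. \<forall>x'\<in>{a..b}. dist x' x < d \<longrightarrow> dist (f x') (f x) < e"
  proof (intro exI[of _ \<delta>] conjI ballI impI)
    fix y assume "y \<in> {a..b}" "dist y x < \<delta>"
    then show "dist (f y) (f x) < e"
      using *[of x y] *[of y x] x
      by (cases "x \<le> y") (auto simp: dist_norm norm_minus_commute)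
  qed fact
qed

lemma abs_continuous_on_scaleR:
  fixes f :: "real \<Rightarrow> real" and g :: "real \<Rightarrow> 'a::real_normed_vector"
  assumes f: "abs_continuous_on {a..b} f" and g: "abs_continuous_on {a..b} g"
  shows "abs_continuous_on {a..b} (\<lambda>x. f x *\<^sub>R g x)"
  unfolding abs_continuous_on_def
proof (intro allI impI)
  have "bounded (f ` {a..b})" "bounded (g ` {a..b})"
    using f g abs_continuous_on_imp_continuous_on compact_continuous_image compact_imp_bounded
    by (blast intro: compact_Icc)+
  then obtain A B where "A > 0" "B > 0"
    and AB: "\<And>x. x \<in> {a..b} \<Longrightarrow> norm (f x) \<le> A" "\<And>x. x \<in> {a..b} \<Longrightarrow> norm (g x) \<le> B"
    unfolding bounded_pos by auto
  fix e :: real assume "e > 0"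
  then have pos: "e / (2 * A) > 0" "e / (2 * B) > 0" using \<open>A > 0\<close> \<open>B > 0\<close> by auto
  obtain d1 where "d1 > 0" and d1: "\<And>D. D division_of \<Union>D \<Longrightarrow> \<Union>D \<subseteq> {a..b} \<Longrightarrow>
      (\<Sum>K\<in>D. Sup K - Inf K) < d1 \<Longrightarrow> (\<Sum>K\<in>D. norm (f (Sup K) - f (Inf K))) < e / (2 * B)"
    using f pos(2) unfolding abs_continuous_on_def by meson
  obtain d2 where "d2 > 0" and d2: "\<And>D. D division_of \<Union>D \<Longrightarrow> \<Union>D \<subseteq> {a..b} \<Longrightarrow>
      (\<Sum>K\<in>D. Sup K - Inf K) < d2 \<Longrightarrow> (\<Sum>K\<in>D. norm (g (Sup K) - g (Inf K))) < e / (2 * A)"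
    using g pos(1) unfolding abs_continuous_on_def by meson
  show "\<exists>d>0. \<forall>D. D division_of \<Union>D \<and> \<Union>D \<subseteq> {a..b} \<and> (\<Sum>K\<in>D. Sup K - Inf K) < d
        \<longrightarrow> (\<Sum>K\<in>D. norm (f (Sup K) *\<^sub>R g (Sup K) - f (Inf K) *\<^sub>R g (Inf K))) < e"
  proof (intro exI[of _ "min d1 d2"] conjI allI impI)
    show "0 < min d1 d2" using \<open>d1 > 0\<close> \<open>d2 > 0\<close> by simp
    fix D :: "real set set"
    assume D: "D division_of \<Union>D \<and> \<Union>D \<subseteq> {a..b} \<and> (\<Sum>K\<in>D. Sup K - Inf K) < min d1 d2"
    have "norm (f (Sup K) *\<^sub>R g (Sup K) - f (Inf K) *\<^sub>R g (Inf K))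
        \<le> A * norm (g (Sup K) - g (Inf K)) + B * norm (f (Sup K) - f (Inf K))" if KD: "K \<in> D" for K
    proof -
      obtain c d where K: "K = {c..d}" "c \<le> d" "Inf K = c" "Sup K = d"
        by (rule division_of_elem_real[of D K]) (use D KD in auto)
      then have "c \<in> K" "d \<in> K" by auto
      then have cd: "c \<in> {a..b}" "d \<in> {a..b}" using D KD by blast+
      have "f d *\<^sub>R g d - f c *\<^sub>R g c = f d *\<^sub>R (g d - g c) + (f d - f c) *\<^sub>R g c"
        by (simp add: algebra_simps)
      also have "norm \<dots> \<le> norm (f d) * norm (g d - g c) + norm (f d - f c) * norm (g c)"
        by (metis norm_scaleR norm_triangle_ineq real_norm_def)
      also have "\<dots> \<le> A * norm (g d - g c) + norm (f d - f c) * B"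
        by (intro add_mono mult_right_mono mult_left_mono AB cd) auto
      finally show ?thesis using K by (simp add: mult.commute)
    qed
    then have "(\<Sum>K\<in>D. norm (f (Sup K) *\<^sub>R g (Sup K) - f (Inf K) *\<^sub>R g (Inf K)))
        \<le> A * (\<Sum>K\<in>D. norm (g (Sup K) - g (Inf K))) + B * (\<Sum>K\<in>D. norm (f (Sup K) - f (Inf K)))"
      by (simp add: sum_distrib_left sum.distrib[symmetric] sum_mono)
    also have "\<dots> < A * (e / (2 * A)) + B * (e / (2 * B))"
      using D \<open>A > 0\<close> \<open>B > 0\<close> by (intro add_strict_mono mult_strict_left_mono d1 d2) auto
    also have "\<dots> = e" using \<open>A > 0\<close> \<open>B > 0\<close> by simp
    finally show "(\<Sum>K\<in>D. norm (f (Sup K) *\<^sub>R g (Sup K) - f (Inf K) *\<^sub>R g (Inf K))) < e" .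
  qed
qed

text \<open>An interval can occur under two different tags only if it is degenerate, since otherwise its
  interior would meet itself. So tags may be dropped for a summand that vanishes on points; this
  passes from tagged divisions to the untagged families of which absolute continuity speaks.\<close>

lemma sum_tagged_partial_division:
  fixes g :: "real set \<Rightarrow> real"
  assumes p: "p tagged_partial_division_of S" and "\<And>c. g {c} = 0"
  shows "(\<Sum>(x, K)\<in>p. g K) = sum g (snd ` p)"
proof -
  have p': "p tagged_division_of \<Union>(snd ` p)"
    using p tagged_partial_division_of_Union_self by blast
  \<comment> \<open>The value of the summand at the empty set is unknown, but no tagged interval is empty.\<close>
  let ?g = "\<lambda>K. if K = {} then 0 else g K"
  have ne: "K \<noteq> {}" if "(x, K) \<in> p" for x K
    using p that by (auto dest: tagged_partial_division_ofD(2))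
  have "(\<Sum>(x, K)\<in>p. g K) = (\<Sum>(x, K)\<in>p. ?g K)"
    by (rule sum.cong) (auto dest: ne)
  also have "\<dots> = sum ?g (snd ` p)"
  proof (rule sum.over_tagged_division_lemma[OF p'])
    fix u v :: real assume "box u v = {}"
    then have "v \<le> u" by simp
    then show "?g (cbox u v) = 0" using assms(2) by (cases "u = v") auto
  qed
  also have "\<dots> = sum g (snd ` p)"
    by (rule sum.cong) (auto dest: ne)
  finally show ?thesis .
qed

text \<open>Absolute continuity makes the exceptional null set \<open>N\<close> harmless: enclose \<open>N\<close> in an open set
  of small measure and choose the gauge so that every interval tagged in \<open>N\<close> lies in this open set.
  These intervals have small total length, hence carry little of the increment of the function.
  On the other intervals the derivative controls the increment, as in the classical proof.\<close>

theorem fundamental_theorem_of_calculus_abs_continuous: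
  fixes f :: "real \<Rightarrow> 'a::banach"
  assumes "a \<le> b" and ac: "abs_continuous_on {a..b} f" and N: "negligible N"
    and deriv: "\<And>x. x \<in> {a..b} - N \<Longrightarrow> (f has_vector_derivative f' x) (at x within {a..b})"
  shows "(f' has_integral (f b - f a)) {a..b}"
proof -
  \<comment> \<open>Changing the derivative on a null set does not affect its integral; with the value \<open>0\<close> the
    tags in \<open>N\<close> contribute nothing to the Riemann sums.\<close>
  define g where "g x = (if x \<in> N then 0 else f' x)" for x
  have "(g has_integral (f b - f a)) {a..b}"
    unfolding has_integral_real
  proof (intro allI impI)
    fix e :: real assume "e > 0"
    define \<eta> where "\<eta> = e / (2 * (b - a + 1))"
    have "\<eta> > 0" and \<eta>: "\<eta> * (b - a) < e / 2"
      using \<open>e > 0\<close> \<open>a \<le> b\<close> by (auto simp: \<eta>_def field_simps)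
    obtain \<delta> where "\<delta> > 0" and \<delta>: "\<And>D. D division_of \<Union>D \<Longrightarrow> \<Union>D \<subseteq> {a..b} \<Longrightarrow>
        (\<Sum>K\<in>D. Sup K - Inf K) < \<delta> \<Longrightarrow> (\<Sum>K\<in>D. norm (f (Sup K) - f (Inf K))) < e / 2"
      using ac \<open>e > 0\<close> unfolding abs_continuous_on_def by (meson half_gt_zero)
    have Nnull: "N \<in> null_sets lebesgue" using N negligible_iff_null_sets by blast
    obtain U where U: "open U" "N \<subseteq> U" "U - N \<in> lmeasurable"
        "emeasure lebesgue (U - N) < ennreal \<delta>"
      using sets_lebesgue_outer_open[OF _ \<open>\<delta> > 0\<close>, of N] Nnull by blast
    have Um: "U \<in> lmeasurable" "measure lebesgue U < \<delta>"
    proof -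
      have UN: "U = (U - N) \<union> N" using U by auto
      have "emeasure lebesgue U = emeasure lebesgue (U - N)"
        using U(1) by (intro emeasure_Diff_null_set[symmetric] Nnull) auto
      with U(4) have *: "emeasure lebesgue U < ennreal \<delta>" by simp
      then show "U \<in> lmeasurable"
        using U(1) by (intro fmeasurableI) (auto simp: less_top top.extremum_strict order_less_trans[OF _ ennreal_less_top])
      then show "measure lebesgue U < \<delta>"
        using * \<open>\<delta> > 0\<close> by (simp add: emeasure_eq_measure2 ennreal_less_iff)
    qed
    have "\<exists>d>0. (x \<in> N \<longrightarrow> ball x d \<subseteq> U) \<and> (x \<in> {a..b} - N \<longrightarrow>
        (\<forall>y\<in>{a..b}. norm (y - x) < d \<longrightarrow> norm (f y - f x - (y - x) *\<^sub>R f' x) \<le> \<eta> * norm (y - x)))" for x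
    proof -
      consider "x \<in> N" | "x \<in> {a..b} - N" | "x \<notin> N" "x \<notin> {a..b}" by blast
      then show ?thesis
      proof cases
        case 1
        then show ?thesis using U(1,2) by (metis DiffD2 open_contains_ball subsetD)
      next
        case 2
        then show ?thesis
          using deriv[OF 2] \<open>\<eta> > 0\<close> unfolding has_vector_derivative_def has_derivative_within_alt
          by blast
      next
        case 3
        then show ?thesis using zero_less_one by blast
      qed
    qed
    then obtain d where d: "\<And>x. 0 < d x" "\<And>x. x \<in> N \<Longrightarrow> ball x (d x) \<subseteq> U"
      "\<And>x y. \<lbrakk>x \<in> {a..b} - N; y \<in> {a..b}; norm (y - x) < d x\<rbrakk>
         \<Longrightarrow> norm (f y - f x - (y - x) *\<^sub>R f' x) \<le> \<eta> * norm (y - x)"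
      by metis
    show "\<exists>\<gamma>. gauge \<gamma> \<and> (\<forall>\<D>. \<D> tagged_division_of {a..b} \<and> \<gamma> fine \<D> \<longrightarrow>
        norm ((\<Sum>(x, k)\<in>\<D>. measure lborel k *\<^sub>R g x) - (f b - f a)) < e)"
    proof (intro exI[of _ "\<lambda>x. ball x (d x)"] conjI allI impI)
      show "gauge (\<lambda>x. ball x (d x))" using d(1) gauge_ball_dependent by blast
      fix p assume "p tagged_division_of {a..b} \<and> (\<lambda>x. ball x (d x)) fine p"
      then have ptag: "p tagged_division_of {a..b}" and fine: "(\<lambda>x. ball x (d x)) fine p" by auto
      have fin: "finite p" using ptag by blast
      \<comment> \<open>the part of the division on which the derivative gives no information\<close>
      define B where "B = {(x, K) \<in> p. x \<in> N}"
      have "B \<subseteq> p" by (auto simp: B_def)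
      have iv: "\<exists>u v. K = {u..v} \<and> u \<le> v \<and> Inf K = u \<and> Sup K = v \<and> x \<in> K \<and> K \<subseteq> {a..b} \<and> K \<subseteq> ball x (d x)"
        if xK: "(x, K) \<in> p" for x K
      proof -
        obtain u v where "K = cbox u v" using tagged_division_ofD(4)[OF ptag xK] by blast
        moreover have "x \<in> K" "K \<subseteq> {a..b}" using tagged_division_ofD(2,3)[OF ptag xK] by auto
        moreover have "K \<subseteq> ball x (d x)" using fine xK by (auto simp: fine_def)
        ultimately show ?thesis by (auto intro!: exI[of _ u] exI[of _ v])
      qed
      define R where "R = (\<lambda>(x, K). measure lborel K *\<^sub>R g x - (f (Sup K) - f (Inf K)))"
      have good: "norm (R z) \<le> \<eta> * (case z of (x, K) \<Rightarrow> Sup K - Inf K)" if "z \<in> p - B" for z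
      proof -
        obtain x K where z: "z = (x, K)" by force
        with that have xK: "(x, K) \<in> p" "x \<notin> N" by (auto simp: B_def)
        obtain u v where K: "K = {u..v}" "u \<le> v" "Inf K = u" "Sup K = v" "x \<in> K" "K \<subseteq> {a..b}"
          "K \<subseteq> ball x (d x)" using iv[OF xK(1)] by blast
        have "u \<in> K" "v \<in> K" using K(1,2) by auto
        then have uv: "u \<in> {a..b}" "v \<in> {a..b}" "u \<in> ball x (d x)" "v \<in> ball x (d x)" "x \<in> {a..b} - N"
          using K(5-7) xK(2) by blast+
        then have uv': "norm (u - x) < d x" "norm (v - x) < d x"
          by (simp_all add: dist_norm norm_minus_commute)
        have "R z = (v - u) *\<^sub>R f' x - (f v - f u)"
          using K(1,2) xK(2) by (simp add: z R_def g_def)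
        also have "\<dots> = (f u - f x - (u - x) *\<^sub>R f' x) - (f v - f x - (v - x) *\<^sub>R f' x)"
          by (simp add: algebra_simps)
        also have "norm \<dots> \<le> \<eta> * norm (u - x) + \<eta> * norm (v - x)"
          by (intro order_trans[OF norm_triangle_ineq4] add_mono d(3) uv uv')
        also have "\<dots> = \<eta> * (v - u)"
          using K(1,5) by (simp add: algebra_simps)
        finally show ?thesis using K(3,4) by (simp add: z)
      qed
      have bad: "norm (R z) = (case z of (x, K) \<Rightarrow> norm (f (Sup K) - f (Inf K)))" if "z \<in> B" for z
        using that by (auto simp: R_def B_def g_def norm_minus_commute)
      have Bpart: "B tagged_partial_division_of {a..b}"
        using ptag[unfolded tagged_division_of_def, THEN conjunct1] \<open>B \<subseteq> p\<close>
        by (rule tagged_partial_division_subset)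
      have Bdiv: "snd ` B division_of \<Union>(snd ` B)"
        using partial_division_of_tagged_division[OF Bpart] .
      have "K \<subseteq> {a..b} \<and> K \<subseteq> U" if "(x, K) \<in> B" for x K
        using iv[of x K] d(2)[of x] that unfolding B_def by blast
      then have sub: "\<Union>(snd ` B) \<subseteq> {a..b}" "\<Union>(snd ` B) \<subseteq> U" by force+
      have "(\<Sum>K\<in>snd ` B. Sup K - Inf K) = (\<Sum>K\<in>snd ` B. measure lebesgue K)"
      proof (rule sum.cong[OF refl])
        fix K assume "K \<in> snd ` B"
        then obtain x where "(x, K) \<in> p" by (auto simp: B_def)
        then obtain u v where "K = {u..v}" "u \<le> v" using iv by blast
        then show "Sup K - Inf K = measure lebesgue K" by simp
      qed
      also have "\<dots> = measure lebesgue (\<Union>(snd ` B))"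
        by (rule content_division[OF Bdiv])
      also have "\<dots> \<le> measure lebesgue U"
        by (rule measure_mono_fmeasurable[OF sub(2) _ Um(1)])
          (use lmeasurable_division[OF Bdiv] in blast)
      also note Um(2)
      finally have "(\<Sum>K\<in>snd ` B. norm (f (Sup K) - f (Inf K))) < e / 2"
        by (rule \<delta>[OF Bdiv sub(1)])
      then have badsum: "(\<Sum>z\<in>B. norm (R z)) < e / 2"
        using sum.cong[OF refl bad, of B] sum_tagged_partial_division[OF Bpart, of "\<lambda>K. norm (f (Sup K) - f (Inf K))"]
        by simp
      have "(\<Sum>z\<in>p - B. norm (R z)) \<le> (\<Sum>z\<in>p - B. \<eta> * (case z of (x, K) \<Rightarrow> Sup K - Inf K))"
        by (rule sum_mono) (rule good)
      also have "\<dots> \<le> (\<Sum>z\<in>p. \<eta> * (case z of (x, K) \<Rightarrow> Sup K - Inf K))"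
      proof (rule sum_mono2[OF fin])
        fix z assume "z \<in> p - (p - B)"
        then obtain x K where "z = (x, K)" "(x, K) \<in> p" by (cases z) auto
        moreover from this obtain u v where "K = {u..v}" "u \<le> v" using iv by blast
        ultimately show "0 \<le> \<eta> * (case z of (x, K) \<Rightarrow> Sup K - Inf K)" using \<open>\<eta> > 0\<close> by simp
      qed auto
      also have "\<dots> = \<eta> * (b - a)"
        using additive_tagged_division_1[OF \<open>a \<le> b\<close> ptag, of "\<lambda>x. x"] by (simp add: sum_distrib_left[symmetric])
      finally have goodsum: "(\<Sum>z\<in>p - B. norm (R z)) < e / 2" using \<eta> by simp
      have "(\<Sum>(x, k)\<in>p. measure lborel k *\<^sub>R g x) - (f b - f a) = sum R p"
        using additive_tagged_division_1[OF \<open>a \<le> b\<close> ptag, of f]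
        by (simp add: R_def case_prod_unfold sum_subtractf)
      also have "norm \<dots> \<le> (\<Sum>z\<in>p. norm (R z))" by (rule norm_sum)
      also have "\<dots> = (\<Sum>z\<in>p - B. norm (R z)) + (\<Sum>z\<in>B. norm (R z))"
        using fin \<open>B \<subseteq> p\<close> by (rule sum.subset_diff[rotated])
      also have "\<dots> < e" using badsum goodsum by simp
      finally show "norm ((\<Sum>(x, k)\<in>p. measure lborel k *\<^sub>R g x) - (f b - f a)) < e" .
    qed
  qed
  then show ?thesis
    by (rule has_integral_spike[OF N, rotated]) (auto simp: g_def)
qed

section \<open>The reachable set of velocities\<close>

text \<open>The function \<open>exp s *\<^sub>R v s\<close> is absolutely continuous, vanishes at \<open>0\<close> and has derivative
  \<open>exp s *\<^sub>R u s\<close> almost everywhere, so its norm at \<open>t\<close> is at most the integral of \<open>exp\<close>.\<close>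

lemma norm_velocity_le:
  fixes i1 :: "'n::finite"
  assumes "t \<ge> 0" and u: "u \<in> admissible_controls" and tr: "trajectory i1 0 u r v"
  shows "norm (v t) \<le> 1 - exp (- t)"
proof -
  have "AE s in lebesgue_on {0..}. (v has_vector_derivative (u s - v s)) (at s within {0..})"
    using tr by (simp add: trajectory_def)
  then have "AE s in lebesgue. s \<in> {0..} \<longrightarrow> (v has_vector_derivative (u s - v s)) (at s within {0..})"
    by (subst (asm) AE_restrict_space_iff) auto
  then obtain N where N: "N \<in> null_sets lebesgue"
    and sub: "{s \<in> space lebesgue. \<not> (s \<in> {0..} \<longrightarrow> (v has_vector_derivative (u s - v s)) (at s within {0..}))} \<subseteq> N"
    unfolding eventually_ae_filter by blast
  have v': "(v has_vector_derivative (u s - v s)) (at s within {0..t})" if "s \<in> {0..t} - N" for s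
  proof (rule has_vector_derivative_within_subset)
    show "(v has_vector_derivative (u s - v s)) (at s within {0..})"
      using that sub by auto
  qed auto
  have "((\<lambda>s. exp s *\<^sub>R u s) has_integral (exp t *\<^sub>R v t - exp 0 *\<^sub>R v 0)) {0..t}"
  proof (rule fundamental_theorem_of_calculus_abs_continuous[OF \<open>t \<ge> 0\<close>])
    have "(exp t)-lipschitz_on {0..t} (exp :: real \<Rightarrow> real)"
    proof (rule bounded_derivative_imp_lipschitz)
      show "(exp has_derivative (\<lambda>h. exp s * h)) (at s within {0..t})" for s :: real
        using DERIV_exp[of s] has_field_derivative_at_within has_field_derivative_def
          by (metis mult_commute_abs)
      show "onorm (\<lambda>h. exp s * h) \<le> exp t" if "s \<in> {0..t}" for s :: real
        using that by (intro onorm_le) (auto simp: abs_mult intro!: mult_right_mono)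
    qed auto
    then show "abs_continuous_on {0..t} (\<lambda>s. exp s *\<^sub>R v s)"
      using tr \<open>t \<ge> 0\<close>
      by (intro abs_continuous_on_scaleR) (auto intro: lipschitz_imp_abs_continuous_on simp: trajectory_def)
    show "negligible N" using N negligible_iff_null_sets by blast
    show "((\<lambda>s. exp s *\<^sub>R v s) has_vector_derivative exp s *\<^sub>R u s) (at s within {0..t})"
      if "s \<in> {0..t} - N" for s
      using has_vector_derivative_scaleR[OF has_field_derivative_at_within[OF DERIV_exp] v'[OF that]]
      by (simp add: algebra_simps)
  qed
  moreover have "v 0 = 0" using tr by (simp add: trajectory_def axis_def vec_eq_iff)
  ultimately have int_u: "((\<lambda>s. exp s *\<^sub>R u s) has_integral exp t *\<^sub>R v t) {0..t}" by simp
  have int_exp: "(exp has_integral (exp t - exp 0)) {0..t}"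
    using \<open>t \<ge> 0\<close> by (intro fundamental_theorem_of_calculus)
      (auto simp: has_real_derivative_iff_has_vector_derivative[symmetric]
        intro: has_field_derivative_at_within)
  have "norm (exp s *\<^sub>R u s) \<le> exp s" if "s \<in> {0..t}" for s
    using u that by (auto simp: admissible_controls_def)
  then have "norm (integral {0..t} (\<lambda>s. exp s *\<^sub>R u s)) \<le> integral {0..t} exp"
    using int_u int_exp by (intro integral_norm_bound_integral) (auto simp: has_integral_iff)
  then have "norm (exp t *\<^sub>R v t) \<le> exp t - 1"
    using int_u int_exp by (simp add: has_integral_iff)
  then show ?thesis by (simp add: exp_minus field_simps)
qed

lemma constant_control_trajectory:
  fixes i1 :: "'n::finite"
  shows "trajectory i1 0 (\<lambda>_. c) (\<lambda>s. (s - 1 + exp (- s)) *\<^sub>R c) (\<lambda>s. (1 - exp (- s)) *\<^sub>R c)"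
proof -
  have r': "((\<lambda>s. (s - 1 + exp (- s)) *\<^sub>R c) has_vector_derivative (1 - exp (- s)) *\<^sub>R c) (at s within S)"
    and v': "((\<lambda>s. (1 - exp (- s)) *\<^sub>R c) has_vector_derivative exp (- s) *\<^sub>R c) (at s within S)"
    for s :: real and S
    by (auto intro!: derivative_eq_intros)
  have ac: "abs_continuous_on {0..T} f"
    if f': "\<And>s. (f has_vector_derivative k s *\<^sub>R c) (at s within {0..T})"
      and k: "\<And>s. s \<in> {0..T} \<Longrightarrow> \<bar>k s\<bar> \<le> 1" for f :: "real \<Rightarrow> real ^ 'n" and k :: "real \<Rightarrow> real" and T
  proof (rule lipschitz_imp_abs_continuous_on)
    show "(norm c)-lipschitz_on {0..T} f"
    proof (rule bounded_derivative_imp_lipschitz)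
      show "(f has_derivative (\<lambda>h. h *\<^sub>R (k s *\<^sub>R c))) (at s within {0..T})" for s
        using f'[of s] by (simp add: has_vector_derivative_def)
      show "onorm (\<lambda>h. h *\<^sub>R (k s *\<^sub>R c)) \<le> norm c" if "s \<in> {0..T}" for s
      proof (rule onorm_le)
        show "norm (h *\<^sub>R (k s *\<^sub>R c)) \<le> norm c * norm h" for h
          using mult_right_mono[OF k[OF that], of "\<bar>h\<bar> * norm c"] by (simp add: abs_mult mult_ac)
      qed
    qed auto
  qed
  have "abs_continuous_on {0..T} (\<lambda>s. (s - 1 + exp (- s)) *\<^sub>R c)"
    "abs_continuous_on {0..T} (\<lambda>s. (1 - exp (- s)) *\<^sub>R c)" for T
    by (rule ac, rule r', simp) (rule ac, rule v', simp)
  moreover have "((\<lambda>s. (1 - exp (- s)) *\<^sub>R c) has_vector_derivative c - (1 - exp (- s)) *\<^sub>R c) (at s within {0..})"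
    for s :: real
    using v'[of s "{0..}"] by (simp add: algebra_simps)
  ultimately show ?thesis
    using r' by (auto simp: trajectory_def axis_def vec_eq_iff)
qed

lemma reach_vI:
  assumes "u \<in> admissible_controls" and "trajectory i1 v0 u r v"
  shows "v t \<in> reach_v i1 v0 t"
  unfolding reach_v_def using assms by blast

theorem reach_v_eq_cball:
  fixes i1 :: "'n::finite"
  assumes "t \<ge> 0"
  shows "reach_v i1 0 t = cball 0 (1 - exp (- t))"
proof (intro subset_antisym subsetI)
  show "x \<in> cball 0 (1 - exp (- t))" if "x \<in> reach_v i1 0 t" for x
    using that norm_velocity_le[OF assms] by (auto simp: reach_v_def)
next
  fix x :: "real ^ 'n" assume "x \<in> cball 0 (1 - exp (- t))"
  then have x: "norm x \<le> 1 - exp (- t)" by simp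
  \<comment> \<open>For \<open>t = 0\<close> the inverse is that of \<open>0\<close>, hence \<open>0\<close>; this is right because \<open>x = 0\<close> then.\<close>
  define c where "c = inverse (1 - exp (- t)) *\<^sub>R x"
  have c: "(1 - exp (- t)) *\<^sub>R c = x" "norm c \<le> 1"
    using x assms by (cases "t = 0"; simp add: c_def field_simps)+
  have "(\<lambda>_. c) \<in> admissible_controls" using c by (simp add: admissible_controls_def)
  then have "(1 - exp (- t)) *\<^sub>R c \<in> reach_v i1 0 t"
    by (rule reach_vI[OF _ constant_control_trajectory])
  then show "x \<in> reach_v i1 0 t" by (simp only: c(1))
qed

text \<open>The minimum is attained at \<open>h\<close> itself or, when \<open>h\<close> lies outside the ball, at its radial
  projection to the sphere.\<close>

lemma Least_norm_diff_cball:
  fixes h :: "'a::real_normed_vector"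
  assumes "R \<ge> 0"
  shows "(LEAST d. d \<in> (\<lambda>x. norm (h - x)) ` cball 0 R) = max 0 (norm h - R)"
proof (rule Least_equality)
  show "max 0 (norm h - R) \<in> (\<lambda>x. norm (h - x)) ` cball 0 R"
  proof (cases "norm h \<le> R")
    case True
    then show ?thesis by (auto intro!: image_eqI[of _ _ h])
  next
    case False
    then have "h \<noteq> 0" "norm h > 0" using assms by auto
    have "norm (h - (R / norm h) *\<^sub>R h) = norm ((1 - R / norm h) *\<^sub>R h)"
      by (simp add: algebra_simps)
    also have "\<dots> = norm h - R"
      using False \<open>norm h > 0\<close> by (simp add: field_simps)
    finally show ?thesis
      using False assms \<open>norm h > 0\<close> by (intro image_eqI[of _ _ "(R / norm h) *\<^sub>R h"]) auto
  qed
  show "max 0 (norm h - R) \<le> d" if "d \<in> (\<lambda>x. norm (h - x)) ` cball 0 R" for d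
  proof -
    obtain x where "norm x \<le> R" "d = norm (h - x)" using \<open>d \<in> _\<close> by auto
    then show ?thesis using norm_triangle_ineq2[of h x] by auto
  qed
qed

lemma rho_reach_v_eq:
  fixes i1 :: "'n::finite"
  assumes "t \<ge> 0"
  shows "rho_reach_v i1 0 t h = max 0 (norm h - (1 - exp (- t)))"
  unfolding rho_reach_v_def reach_v_eq_cball[OF assms]
  using assms by (intro Least_norm_diff_cball) simp

section \<open>The capture time\<close>

lemma mult_exp_inj_on: "inj_on (\<lambda>w::real. w * exp w) {-1..}"
proof (rule strict_mono_on_imp_inj_on, rule strict_mono_onI)
  fix x y :: real assume "x \<in> {-1..}" "y \<in> {-1..}" "x < y"
  show "x * exp x < y * exp y"
  proof (rule DERIV_pos_imp_increasing_open[OF \<open>x < y\<close>])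
    fix w assume "x < w" "w < y"
    have "((\<lambda>w. w * exp w) has_real_derivative (w + 1) * exp w) (at w)"
      by (auto intro!: derivative_eq_intros simp: algebra_simps)
    moreover have "(w + 1) * exp w > 0" using \<open>x < w\<close> \<open>x \<in> {-1..}\<close> by simp
    ultimately show "\<exists>D. ((\<lambda>w. w * exp w) has_real_derivative D) (at w) \<and> D > 0" by blast
  qed (intro continuous_intros)
qed

text \<open>A preimage of \<open>x\<close> is found between \<open>0\<close> and \<open>x\<close> by the intermediate value theorem.\<close>

lemma lambert_W0_mult_exp:
  assumes "x \<ge> 0"
  shows "lambert_W0 x * exp (lambert_W0 x) = x"
proof -
  have "x * 1 \<le> x * exp x" using assms by (intro mult_left_mono) auto
  then have "\<exists>w\<ge>0. w \<le> x \<and> w * exp w = x"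
    using assms by (intro IVT') (auto intro!: continuous_intros)
  then have "x \<in> (\<lambda>w. w * exp w) ` {-1..}" by force
  then show ?thesis
    unfolding lambert_W0_def using f_the_inv_into_f[OF mult_exp_inj_on] by simp
qed

text \<open>Dropping the truncation at \<open>0\<close> in the distance leaves the strictly increasing function \<open>F\<close>
  below. It is negative at \<open>t\<close> because the target starts outside the capture radius, so its zero
  \<open>s\<close> lies after \<open>t\<close>. There the untruncated distance equals a nonnegative number and is
  therefore the distance itself. Conversely, the truncation only increases the distance, so
  \<open>F\<close> is nonnegative at every time of capture, and none of them precedes \<open>s\<close>. For \<open>l = 0\<close> and
  \<open>v = 0\<close> every later time is one of capture as well; hence \<open>s\<close> is only the least.\<close>

lemma lower_estimator_eqI:
  fixes i1 :: "'n::finite"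
  assumes "l \<ge> 0" "v \<ge> 0" "t \<ge> 0" and far: "rho_reach_v i1 0 t h > l"
    and root: "norm h - (1 - exp (- s)) = v * (s - t) + l"
  shows "lower_estimator (rho_reach_v i1 0) v l t h = ereal s"
proof -
  define F where "F \<theta> = v * (\<theta> - t) + l - (norm h - (1 - exp (- \<theta>)))" for \<theta>
  have F: "F x < F y" if "x < y" for x y
    using that mult_left_mono[of x y v] \<open>v \<ge> 0\<close> unfolding F_def by (smt (verit) exp_less_mono right_diff_distrib)
  have "F t < 0" using far \<open>l \<ge> 0\<close> \<open>t \<ge> 0\<close> by (auto simp: F_def rho_reach_v_eq)
  moreover have "F s = 0" using root by (simp add: F_def)
  ultimately have "t < s" using F by (metis linorder_less_linear order.asym)
  let ?S = "{\<theta>. 0 \<le> \<theta> \<and> t \<le> \<theta> \<and> rho_reach_v i1 0 \<theta> h = v * (\<theta> - t) + l}"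
  have "v * (s - t) \<ge> 0" using \<open>t < s\<close> \<open>v \<ge> 0\<close> by simp
  then have mem: "s \<in> ?S"
    using \<open>t < s\<close> \<open>t \<ge> 0\<close> \<open>l \<ge> 0\<close> root by (simp add: rho_reach_v_eq)
  have "s \<le> \<theta>" if "\<theta> \<in> ?S" for \<theta>
  proof (rule ccontr)
    assume "\<not> s \<le> \<theta>"
    then have "F \<theta> < 0" using F \<open>F s = 0\<close> by (metis not_le)
    moreover have "F \<theta> \<ge> 0" using that by (auto simp: F_def rho_reach_v_eq)
    ultimately show False by simp
  qed
  then have "(LEAST \<theta>. \<theta> \<in> ?S) = s" using mem by (intro Least_equality)
  then show ?thesis using mem unfolding lower_estimator_def Let_def by auto
qed

theorem theorem6:
  fixes i1 :: "'n::finite" and v0 l v t :: real and h :: "real ^ 'n"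
  assumes "v0 = 0" and "l \<ge> 0" and "v \<ge> 0" and "t \<ge> 0"
    and "rho_reach_v i1 v0 t h > l"
  shows "lower_estimator (rho_reach_v i1 v0) v l t h =
    (if v = 0 then
       (if 1 + l \<le> norm h then \<infinity> else ereal (- ln (1 + l - norm h)))
     else
       ereal ((v * t + norm h - 1 - l) / v
              + lambert_W0 (exp (- t + (1 + l - norm h) / v) / v)))"
proof -
  \<comment> \<open>It suffices to exhibit a root of the untruncated equation.\<close>
  note far = \<open>rho_reach_v i1 v0 t h > l\<close>[unfolded \<open>v0 = 0\<close>]
  note eqI = lower_estimator_eqI[OF \<open>l \<ge> 0\<close> \<open>v \<ge> 0\<close> \<open>t \<ge> 0\<close> far]
  show ?thesis
  proof (cases "v = 0")
    case v: True
    show ?thesis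
    proof (cases "1 + l \<le> norm h")
      case True
      have "rho_reach_v i1 0 \<theta> h \<noteq> l" if "\<theta> \<ge> 0" for \<theta>
      proof -
        \<comment> \<open>the velocities reachable at any time have norm strictly below \<open>1\<close>\<close>
        have "0 < exp (- \<theta>)" by simp
        with True have "norm h - (1 - exp (- \<theta>)) > l" by linarith
        then show ?thesis using that by (simp add: rho_reach_v_eq)
      qed
      then show ?thesis using True v \<open>v0 = 0\<close> by (simp add: lower_estimator_def)
    next
      case False
      then show ?thesis using v \<open>v0 = 0\<close> eqI[of "- ln (1 + l - norm h)"] by simp
    qed
  next
    case False
    with \<open>v \<ge> 0\<close> have "v > 0" by simp
    define a where "a = (v * t + norm h - 1 - l) / v"
    define x where "x = exp (- a) / v"
    define w where "w = lambert_W0 x"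
    have a: "- t + (1 + l - norm h) / v = - a"
      using \<open>v > 0\<close> by (simp add: a_def field_simps)
    have "w * exp w = x" using \<open>v > 0\<close> unfolding w_def x_def by (intro lambert_W0_mult_exp) simp
    then have "exp (- a) = v * w * exp w" using \<open>v > 0\<close> by (simp add: x_def field_simps)
    then have "exp (- (a + w)) = v * w" by (simp add: exp_add exp_minus exp_diff field_simps)
    moreover have "v * (a + w - t) = norm h - 1 - l + v * w"
      using \<open>v > 0\<close> by (simp add: a_def field_simps)
    ultimately have "norm h - (1 - exp (- (a + w))) = v * (a + w - t) + l" by linarith
    from eqI[OF this] show ?thesis
      by (simp only: a a_def[symmetric] w_def x_def False \<open>v0 = 0\<close> if_False)
  qed
qed

end
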